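(* Let $\mathscr{A}$ be a $C^*$-algebra equipped with a $*$-conjugate-automorphism $\sharp$ and let $\mathscr{E}$ be a right Hilbert $\mathscr{A}$-module equipped with a $\sharp$-conjugation $C$. Let $\mathscr{E}'_{c,\sharp}$ be the $\sharp$-conjugate dual of $\mathscr{E}$ and $\mathscr{E}'$ the ordinary $\mathscr{A}$-module dual. Then $$\Phi:\mathscr{E}'_{c,\sharp}\to\mathscr{E}',\qquad \Phi(f)=f\circ C,$$ is a bijective right $\mathscr{A}$-module map, with inverse $\Phi^{-1}(g)=g\circ C$. Consequently, $\mathscr{E}'_{c,\sharp}\cong\mathscr{E}'$ as right $\mathscr{A}$-modules. With respect to the operator norms on $\mathscr{E}'$ and $\mathscr{E}'_{c,\sharp}$, $\Phi$ is isometric.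
   Context: A $*$-conjugate-automorphism on a $C^*$-algebra $\mathscr{A}$ is a map $\sharp:\mathscr{A}\to\mathscr{A}$, $a\mapsto a^\sharp$, such that for all $a,b\in\mathscr{A}$, $\lambda\in\mathbb{C}$: (1) $(\lambda a+b)^\sharp=\bar\lambda a^\sharp+b^\sharp$; (2) $(a^\sharp)^\sharp=a$; (3) $(a^\sharp)^*=(a^* )^\sharp$; (4) $(ab)^\sharp=a^\sharp b^\sharp$. A $\sharp$-conjugation on $\mathscr{E}$ is a bounded conjugate-linear operator $C:\mathscr{E}\to\mathscr{E}$ with $C^2=I_{\mathscr{E}}$ and $\langle Cx,Cy\rangle=\langle x,y\rangle^\sharp$ for all $x,y\in\mathscr{E}$ (inner products are conjugate-linear in the first variable). The $\sharp$-conjugate dual $\mathscr{E}'_{c,\sharp}$ is the set of bounded conjugate-linear maps $f:\mathscr{E}\to\mathscr{A}$ with $f(xa)=f(x)a^\sharp$ for all $x\in\mathscr{E}$, $a\in\mathscr{A}$. The ordinary dual $\mathscr{E}'$ is the set of bounded linear maps $g:\mathscr{E}\to\mathscr{A}$ with $g(xa)=g(x)a$ for all $x\in\mathscr{E}$, $a\in\mathscr{A}$. Both carry the right $\mathscr{A}$-module structure $(fa)(x)=a^*f(x)$. *)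

theory Defs
  imports "HOL-Analysis.Analysis" "HOL-Library.Function_Algebras"
begin

class complex_normed_space = real_normed_vector +
  fixes scaleC :: "complex \<Rightarrow> 'a \<Rightarrow> 'a" (infixr \<open>*\<^sub>C\<close> 75)
  assumes scaleC_add_right: "c *\<^sub>C (x + y) = c *\<^sub>C x + c *\<^sub>C y"
    and scaleC_add_left: "(c + d) *\<^sub>C x = c *\<^sub>C x + d *\<^sub>C x"
    and scaleC_scaleC: "c *\<^sub>C d *\<^sub>C x = (c * d) *\<^sub>C x"
    and scaleC_of_real: "complex_of_real r *\<^sub>C x = r *\<^sub>R x"
    and norm_scaleC: "norm (c *\<^sub>C x) = cmod c * norm x"

text \<open>C*-algebras are not assumed to have a unit.\<close>

class cstar_algebra = complex_normed_space + real_normed_algebra + banach +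
  fixes star :: "'a \<Rightarrow> 'a"
  assumes mult_scaleC_left: "(c *\<^sub>C a) * b = c *\<^sub>C (a * b)"
    and mult_scaleC_right: "a * (c *\<^sub>C b) = c *\<^sub>C (a * b)"
    and star_add: "star (a + b) = star a + star b"
    and star_scaleC: "star (c *\<^sub>C a) = cnj c *\<^sub>C star a"
    and star_mult: "star (a * b) = star b * star a"
    and star_star: "star (star a) = a"
    and norm_star_mult_self: "norm (star a * a) = (norm a)\<^sup>2"

definition cstar_positive :: "'a::cstar_algebra \<Rightarrow> bool" where
  "cstar_positive a \<longleftrightarrow> (\<exists>b. a = star b * b)"

definition bounded_clinear ::
    "('e::complex_normed_space \<Rightarrow> 'f::complex_normed_space) \<Rightarrow> bool" where
  "bounded_clinear f \<longleftrightarrow> bounded_linear f \<and> (\<forall>c x. f (c *\<^sub>C x) = c *\<^sub>C f x)"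

definition bounded_conj_linear ::
    "('e::complex_normed_space \<Rightarrow> 'f::complex_normed_space) \<Rightarrow> bool" where
  "bounded_conj_linear f \<longleftrightarrow> bounded_linear f \<and> (\<forall>c x. f (c *\<^sub>C x) = cnj c *\<^sub>C f x)"

text \<open>
  A right module over the complex algebra \<open>'a\<close>, with carrier an additive subgroup \<open>M\<close> of the
  ambient group. As usual for modules over an algebra, it is also a complex vector space, with
  scalars compatible with those of \<open>'a\<close>.
\<close>

locale right_module =
  fixes M :: "'m::ab_group_add set"
    and scale :: "complex \<Rightarrow> 'm \<Rightarrow> 'm"
    and act :: "'m \<Rightarrow> 'a::cstar_algebra \<Rightarrow> 'm"
  assumes zero_closed: "0 \<in> M"
    and add_closed: "\<lbrakk>x \<in> M; y \<in> M\<rbrakk> \<Longrightarrow> x + y \<in> M"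
    and uminus_closed: "x \<in> M \<Longrightarrow> - x \<in> M"
    and scale_closed: "x \<in> M \<Longrightarrow> scale c x \<in> M"
    and act_closed: "x \<in> M \<Longrightarrow> act x a \<in> M"
    and scale_add_right: "\<lbrakk>x \<in> M; y \<in> M\<rbrakk> \<Longrightarrow> scale c (x + y) = scale c x + scale c y"
    and scale_add_left: "x \<in> M \<Longrightarrow> scale (c + d) x = scale c x + scale d x"
    and scale_scale: "x \<in> M \<Longrightarrow> scale c (scale d x) = scale (c * d) x"
    and scale_one: "x \<in> M \<Longrightarrow> scale 1 x = x"
    and act_add_left: "\<lbrakk>x \<in> M; y \<in> M\<rbrakk> \<Longrightarrow> act (x + y) a = act x a + act y a"
    and act_add_right: "x \<in> M \<Longrightarrow> act x (a + b) = act x a + act x b"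
    and act_mult: "x \<in> M \<Longrightarrow> act x (a * b) = act (act x a) b"
    and act_scale_left: "x \<in> M \<Longrightarrow> act (scale c x) a = scale c (act x a)"
    and act_scale_right: "x \<in> M \<Longrightarrow> act x (c *\<^sub>C a) = scale c (act x a)"

locale right_module_hom =
  dom: right_module M scale\<^sub>M act\<^sub>M + cod: right_module N scale\<^sub>N act\<^sub>N
  for M :: "'m::ab_group_add set" and scale\<^sub>M and act\<^sub>M :: "'m \<Rightarrow> 'a::cstar_algebra \<Rightarrow> 'm"
    and N :: "'n::ab_group_add set" and scale\<^sub>N and act\<^sub>N :: "'n \<Rightarrow> 'a \<Rightarrow> 'n" +
  fixes \<phi> :: "'m \<Rightarrow> 'n"
  assumes maps_to: "x \<in> M \<Longrightarrow> \<phi> x \<in> N"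
    and map_add: "\<lbrakk>x \<in> M; y \<in> M\<rbrakk> \<Longrightarrow> \<phi> (x + y) = \<phi> x + \<phi> y"
    and map_scale: "x \<in> M \<Longrightarrow> \<phi> (scale\<^sub>M c x) = scale\<^sub>N c (\<phi> x)"
    and map_act: "x \<in> M \<Longrightarrow> \<phi> (act\<^sub>M x a) = act\<^sub>N (\<phi> x) a"

definition right_module_isomorphic ::
    "'m::ab_group_add set \<Rightarrow> (complex \<Rightarrow> 'm \<Rightarrow> 'm) \<Rightarrow> ('m \<Rightarrow> 'a::cstar_algebra \<Rightarrow> 'm) \<Rightarrow>
     'n::ab_group_add set \<Rightarrow> (complex \<Rightarrow> 'n \<Rightarrow> 'n) \<Rightarrow> ('n \<Rightarrow> 'a \<Rightarrow> 'n) \<Rightarrow> bool" where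
  "right_module_isomorphic M scale\<^sub>M act\<^sub>M N scale\<^sub>N act\<^sub>N \<longleftrightarrow>
     (\<exists>\<phi>. right_module_hom M scale\<^sub>M act\<^sub>M N scale\<^sub>N act\<^sub>N \<phi> \<and> bij_betw \<phi> M N)"

text \<open>
  Conjugate-linearity of the inner product in the first variable follows from \<open>ip_star\<close>.
  Completeness is the class \<open>banach\<close>, whose norm \<open>norm_eq_sqrt_ip\<close> identifies with the
  inner product norm.
\<close>

locale hilbert_module = right_module UNIV scaleC act
  for act :: "'e::{complex_normed_space, banach} \<Rightarrow> 'a::cstar_algebra \<Rightarrow> 'e" +
  fixes ip :: "'e \<Rightarrow> 'e \<Rightarrow> 'a"
  assumes ip_add_right: "ip x (y + z) = ip x y + ip x z"
    and ip_scaleC_right: "ip x (c *\<^sub>C y) = c *\<^sub>C ip x y"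
    and ip_act_right: "ip x (act y a) = ip x y * a"
    and ip_star: "star (ip x y) = ip y x"
    and ip_positive: "cstar_positive (ip x x)"
    and ip_definite: "ip x x = 0 \<Longrightarrow> x = 0"
    and norm_eq_sqrt_ip: "norm x = sqrt (norm (ip x x))"

locale star_conj_automorphism =
  fixes sharp :: "'a::cstar_algebra \<Rightarrow> 'a"
  assumes sharp_conj_linear: "sharp (c *\<^sub>C a + b) = cnj c *\<^sub>C sharp a + sharp b"
    and sharp_sharp: "sharp (sharp a) = a"
    and star_sharp: "star (sharp a) = sharp (star a)"
    and sharp_mult: "sharp (a * b) = sharp a * sharp b"

definition sharp_conjugation ::
    "('a::cstar_algebra \<Rightarrow> 'a) \<Rightarrow> ('e::complex_normed_space \<Rightarrow> 'e \<Rightarrow> 'a) \<Rightarrow> ('e \<Rightarrow> 'e) \<Rightarrow> bool" where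
  "sharp_conjugation sharp ip C \<longleftrightarrow>
     bounded_conj_linear C \<and> C \<circ> C = id \<and> (\<forall>x y. ip (C x) (C y) = sharp (ip x y))"

definition module_dual ::
    "('e::complex_normed_space \<Rightarrow> 'a::cstar_algebra \<Rightarrow> 'e) \<Rightarrow> ('e \<Rightarrow> 'a) set" where
  "module_dual act = {g. bounded_clinear g \<and> (\<forall>x a. g (act x a) = g x * a)}"

definition conj_dual ::
    "('a::cstar_algebra \<Rightarrow> 'a) \<Rightarrow> ('e::complex_normed_space \<Rightarrow> 'a \<Rightarrow> 'e) \<Rightarrow> ('e \<Rightarrow> 'a) set" where
  "conj_dual sharp act = {f. bounded_conj_linear f \<and> (\<forall>x a. f (act x a) = f x * sharp a)}"

definition dual_act :: "('e \<Rightarrow> 'a::cstar_algebra) \<Rightarrow> 'a \<Rightarrow> 'e \<Rightarrow> 'a" where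
  "dual_act f a = (\<lambda>x. star a * f x)"

text \<open>
  Since \<open>dual_act f\<close> is conjugate-linear, compatibility of the scalars of the two duals with those
  of the algebra requires the conjugate of the pointwise scalar multiplication. Addition is
  pointwise.
\<close>

definition dual_scale :: "complex \<Rightarrow> ('e \<Rightarrow> 'a::cstar_algebra) \<Rightarrow> 'e \<Rightarrow> 'a" where
  "dual_scale c f = (\<lambda>x. cnj c *\<^sub>C f x)"

end

theory Submission
  imports Defs
begin

text \<open>
  The point is that \<open>C\<close> is isometric, which needs no spectral theory. Since \<open>C\<close> is surjective and
  the inner product is definite, \<open>C (x a) = C x a\<^sup>\<sharp>\<close>; hence \<open>C\<close> commutes with the map
  \<open>q x = x \<langle>x, x\<rangle>\<close>, which by the C*-identity satisfies \<open>\<parallel>q x\<parallel> = \<parallel>x\<parallel>\<^sup>3\<close>. So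
  \<open>\<parallel>C x\<parallel>\<^sup>3 = \<parallel>C (q x)\<parallel> \<le> \<parallel>C\<parallel> \<parallel>x\<parallel>\<^sup>3\<close>, that is \<open>\<parallel>C\<parallel>\<^sup>3 \<le> \<parallel>C\<parallel>\<close>, and the
  involution \<open>C\<close> is contractive.
\<close>

lemma bounded_linear_scaleC: "bounded_linear ((*\<^sub>C) c :: 'a::complex_normed_space \<Rightarrow> 'a)"
proof (rule bounded_linear_intro[where K = "cmod c"])
  fix r :: real and x :: 'a
  show "c *\<^sub>C r *\<^sub>R x = r *\<^sub>R c *\<^sub>C x"
    by (simp flip: scaleC_of_real add: scaleC_scaleC mult.commute)
qed (simp_all add: scaleC_add_right norm_scaleC mult.commute)

lemmas scaleC_zero_right = linear_0[OF bounded_linear.linear[OF bounded_linear_scaleC]]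
  and scaleC_minus_right = linear_neg[OF bounded_linear.linear[OF bounded_linear_scaleC]]

lemma scaleC_one: "1 *\<^sub>C x = x"
  using scaleC_of_real[of 1 x] by simp

text \<open>Submultiplicativity gives one inequality. For the other, the C*-identity applied to
  \<open>a\<close> and to \<open>a * a\<close> makes the fourth power of \<open>norm a\<close> the
  norm of the fourth power of \<open>a\<close>; splitting off one factor and cancelling it leaves
  the cube.\<close>

lemma norm_selfadjoint_cube:
  fixes a :: "'a::cstar_algebra"
  assumes "star a = a"
  shows "norm (a * (a * a)) = norm a ^ 3"
proof (rule antisym)
  have "norm (a * (a * a)) \<le> norm a * (norm a * norm a)"
    by (rule order_trans[OF norm_mult_ineq mult_left_mono[OF norm_mult_ineq]]) simp
  then show "norm (a * (a * a)) \<le> norm a ^ 3"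
    by (simp add: power3_eq_cube mult.assoc)
  have sq: "norm (b * b) = (norm b)\<^sup>2" if "star b = b" for b :: 'a
    using norm_star_mult_self[of b] that by simp
  have "norm a * norm a ^ 3 = norm ((a * a) * (a * a))"
    using sq[of a] sq[of "a * a"] assms
    by (simp add: star_mult power2_eq_square power3_eq_cube mult.assoc)
  also have "\<dots> \<le> norm a * norm (a * (a * a))"
    using norm_mult_ineq[of a "a * (a * a)"] by (simp add: mult.assoc)
  finally have "norm a * norm a ^ 3 \<le> norm a * norm (a * (a * a))" .
  then show "norm a ^ 3 \<le> norm (a * (a * a))"
    by (cases "norm a = 0") (auto simp: mult_le_cancel_left)
qed

text \<open>
  A common form of the two duals: \<open>\<sigma>\<close> and \<open>\<tau>\<close> are the identities for \<open>module_dual\<close>, and complex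
  conjugation and \<open>\<sharp>\<close> for \<open>conj_dual\<close>.
\<close>

definition twisted_dual ::
    "(complex \<Rightarrow> complex) \<Rightarrow> ('a::cstar_algebra \<Rightarrow> 'a) \<Rightarrow>
     ('e::complex_normed_space \<Rightarrow> 'a \<Rightarrow> 'e) \<Rightarrow> ('e \<Rightarrow> 'a) set" where
  "twisted_dual \<sigma> \<tau> act = {f. bounded_linear f \<and> (\<forall>c x. f (c *\<^sub>C x) = \<sigma> c *\<^sub>C f x)
     \<and> (\<forall>x a. f (act x a) = f x * \<tau> a)}"

lemma module_dual_eq_twisted: "module_dual act = twisted_dual (\<lambda>c. c) (\<lambda>a. a) act"
  by (auto simp: module_dual_def twisted_dual_def bounded_clinear_def)

lemma conj_dual_eq_twisted: "conj_dual sharp act = twisted_dual cnj sharp act"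
  by (auto simp: conj_dual_def twisted_dual_def bounded_conj_linear_def)

text \<open>Both operations act on values from the left, so they commute with the twists, which
  enter through scalars and right multiplication. The conjugate in \<open>dual_scale\<close> matches
  \<open>star_scaleC\<close>.\<close>

lemma right_module_twisted_dual:
  fixes act :: "'e::complex_normed_space \<Rightarrow> 'a::cstar_algebra \<Rightarrow> 'e"
  shows "right_module (twisted_dual \<sigma> \<tau> act) dual_scale dual_act"
proof
  fix f g :: "'e \<Rightarrow> 'a" and c :: complex and a :: 'a
  show "0 \<in> twisted_dual \<sigma> \<tau> act"
    by (simp add: twisted_dual_def zero_fun_def bounded_linear_zero scaleC_zero_right)
  assume f: "f \<in> twisted_dual \<sigma> \<tau> act"
  show "- f \<in> twisted_dual \<sigma> \<tau> act"
    using f by (simp add: twisted_dual_def fun_Compl_def bounded_linear_minus scaleC_minus_right)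
  show "dual_scale c f \<in> twisted_dual \<sigma> \<tau> act"
    using f
    by (simp add: twisted_dual_def dual_scale_def scaleC_scaleC mult.commute mult_scaleC_left
        bounded_linear_compose[OF bounded_linear_scaleC])
  show "dual_act f a \<in> twisted_dual \<sigma> \<tau> act"
    using f
    by (simp add: twisted_dual_def dual_act_def mult_scaleC_right mult.assoc
        bounded_linear_compose[OF bounded_linear_mult_right])
  assume "g \<in> twisted_dual \<sigma> \<tau> act"
  with f show "f + g \<in> twisted_dual \<sigma> \<tau> act"
    by (simp add: twisted_dual_def plus_fun_def bounded_linear_add scaleC_add_right distrib_right)
qed (simp_all add: dual_scale_def dual_act_def fun_eq_iff scaleC_add_right scaleC_add_left
    scaleC_scaleC scaleC_one distrib_left distrib_right star_add star_mult star_scaleC mult.assoc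
    mult_scaleC_left mult_scaleC_right mult.commute[where 'a = complex])

text \<open>Since \<open>cnj\<close> and \<open>sharp\<close> are involutions, this single
  computation sends each dual into the other.\<close>

lemma twisted_dual_compose:
  assumes "f \<in> twisted_dual \<sigma> \<tau> act" and "bounded_conj_linear C"
    and "\<And>x a. C (act x a) = act (C x) (sharp a)"
  shows "f \<circ> C \<in> twisted_dual (\<lambda>c. \<sigma> (cnj c)) (\<lambda>a. \<tau> (sharp a)) act"
  using assms bounded_linear_compose[of f C]
  by (simp add: twisted_dual_def bounded_conj_linear_def o_def)

context hilbert_module
begin

lemma ip_act_left: "ip (act x a) y = star a * ip x y"
  by (metis ip_act_right ip_star star_mult)

lemma ip_eqI:
  assumes "\<And>z. ip z x = ip z y"
  shows "x = y"
proof -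
  have "ip z x = ip z (x - y) + ip z y" for z
    using ip_add_right[of z "x - y" y] by simp
  \<comment> \<open>Take \<open>z = x - y\<close>.\<close>
  with assms have "ip (x - y) (x - y) = 0"
    by (metis add_cancel_left_left)
  then show ?thesis
    using ip_definite by fastforce
qed

text \<open>For the self-adjoint \<open>a = ip x x\<close>, the inner product of
  \<open>act x a\<close> with itself is \<open>a * (a * a)\<close>.\<close>

lemma norm_act_ip_self: "norm (act x (ip x x)) = norm x ^ 3"
  by (simp add: norm_eq_sqrt_ip ip_act_left ip_act_right ip_star norm_selfadjoint_cube
      real_sqrt_power mult.assoc)

end

lemma onorm_le_oneI:
  assumes f: "bounded_linear f" and cube: "\<And>x. norm (f x) ^ 3 \<le> onorm f * norm x ^ 3"
  shows "onorm f \<le> 1"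
proof -
  let ?L = "onorm f"
  have L: "?L \<ge> 0" by (rule onorm_pos_le[OF f])
  have "norm (f x) \<le> root 3 ?L * norm x" for x
  proof (rule power_le_imp_le_base)
    \<comment> \<open>\<open>power_le_imp_le_base\<close> takes its exponent as a successor.\<close>
    show "norm (f x) ^ Suc 2 \<le> (root 3 ?L * norm x) ^ Suc 2"
      using cube[of x] L by (simp add: power_mult_distrib eval_nat_numeral(3)[symmetric])
  qed (use L in simp)
  then have "?L \<le> root 3 ?L"
    using L by (intro onorm_bound) auto
  then have "?L ^ 3 \<le> ?L"
    using power_mono[of ?L "root 3 ?L" 3] L by simp
  then have "\<not> ?L > 1"
    using power_strict_increasing[of 1 3 ?L] by auto
  then show ?thesis by simp
qed

locale sharp_hilbert_module = hilbert_module act ip + star_conj_automorphism sharp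
  for act :: "'e::{complex_normed_space, banach} \<Rightarrow> 'a::cstar_algebra \<Rightarrow> 'e"
    and ip sharp +
  fixes C :: "'e \<Rightarrow> 'e"
  assumes conjugation: "sharp_conjugation sharp ip C"
begin

lemma conj_linear: "bounded_conj_linear C"
  and bounded_linear: "bounded_linear C"
  and involutive: "C (C x) = x"
  and ip_conj: "ip (C x) (C y) = sharp (ip x y)"
  using conjugation by (simp_all add: sharp_conjugation_def bounded_conj_linear_def fun_eq_iff)

lemma conj_act: "C (act x a) = act (C x) (sharp a)"
proof (rule ip_eqI)
  fix z
  show "ip z (C (act x a)) = ip z (act (C x) (sharp a))"
    \<comment> \<open>As \<open>z = C (C z)\<close>, the conjugation rule turns both sides into
      \<open>sharp (ip (C z) x) * sharp a\<close>.\<close>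
    using ip_conj[of "C z"] by (simp add: involutive ip_act_right sharp_mult)
qed

lemma onorm_conj_le: "onorm C \<le> 1"
proof (rule onorm_le_oneI[OF bounded_linear])
  fix x
  \<comment> \<open>Because \<open>sharp (ip x x) = ip (C x) (C x)\<close>, the vector on the right
    is \<open>act (C x) (ip (C x) (C x))\<close>.\<close>
  have "norm (C x) ^ 3 = norm (C (act x (ip x x)))"
    by (simp add: conj_act ip_conj norm_act_ip_self flip: ip_conj)
  also have "\<dots> \<le> onorm C * norm x ^ 3"
    using onorm[OF bounded_linear, of "act x (ip x x)"] by (simp add: norm_act_ip_self)
  finally show "norm (C x) ^ 3 \<le> onorm C * norm x ^ 3" .
qed

lemma onorm_compose_conj:
  fixes f :: "'e \<Rightarrow> 'b::real_normed_vector"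
  assumes f: "bounded_linear f"
  shows "onorm (f \<circ> C) = onorm f"
proof -
  have le: "onorm (g \<circ> C) \<le> onorm g" if "bounded_linear g" for g :: "'e \<Rightarrow> 'b"
    using onorm_compose[OF that bounded_linear]
      mult_left_mono[OF onorm_conj_le onorm_pos_le[OF that]] by simp
  have "bounded_linear (f \<circ> C)"
    using bounded_linear_compose[OF f bounded_linear] by (simp add: o_def)
  \<comment> \<open>The bound for \<open>f \<circ> C\<close> is the reverse inequality, since
    composing with \<open>C\<close> once more returns \<open>f\<close>.\<close>
  from le[OF this] le[OF f] show ?thesis
    by (simp add: o_def involutive)
qed

lemma conj_dual_compose: "f \<in> conj_dual sharp act \<Longrightarrow> f \<circ> C \<in> module_dual act"
  using twisted_dual_compose[of f cnj sharp act C sharp] conj_linear conj_act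
  by (simp add: conj_dual_eq_twisted module_dual_eq_twisted sharp_sharp)

lemma module_dual_compose: "g \<in> module_dual act \<Longrightarrow> g \<circ> C \<in> conj_dual sharp act"
  using twisted_dual_compose[of g "\<lambda>c. c" "\<lambda>a. a" act C sharp] conj_linear conj_act
  by (simp add: conj_dual_eq_twisted module_dual_eq_twisted)

lemma compose_conj_compose_conj: "f \<circ> C \<circ> C = f"
  by (simp add: fun_eq_iff involutive)

lemma bij_betw_compose_conj: "bij_betw (\<lambda>f. f \<circ> C) (conj_dual sharp act) (module_dual act)"
  by (rule bij_betwI[where g = "\<lambda>g. g \<circ> C"])
    (simp_all add: conj_dual_compose module_dual_compose compose_conj_compose_conj)

lemma right_module_hom_compose_conj:
  "right_module_hom (conj_dual sharp act) dual_scale dual_act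
     (module_dual act) dual_scale dual_act (\<lambda>f. f \<circ> C)"
proof (intro right_module_hom.intro right_module_hom_axioms.intro)
  show "right_module (conj_dual sharp act) dual_scale dual_act"
    "right_module (module_dual act) dual_scale dual_act"
    by (simp_all add: conj_dual_eq_twisted module_dual_eq_twisted right_module_twisted_dual)
qed (simp_all add: conj_dual_compose dual_scale_def dual_act_def fun_eq_iff)

end

theorem theorem4p9:
  fixes sharp :: "'a::cstar_algebra \<Rightarrow> 'a"
    and act :: "'e::{complex_normed_space, banach} \<Rightarrow> 'a \<Rightarrow> 'e"
    and ip :: "'e \<Rightarrow> 'e \<Rightarrow> 'a"
    and C :: "'e \<Rightarrow> 'e"
  assumes "star_conj_automorphism sharp"
    and "hilbert_module act ip"
    and "sharp_conjugation sharp ip C"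
  shows "right_module_hom (conj_dual sharp act) dual_scale dual_act
           (module_dual act) dual_scale dual_act (\<lambda>f. f \<circ> C)
       \<and> bij_betw (\<lambda>f. f \<circ> C) (conj_dual sharp act) (module_dual act)
       \<and> (\<forall>g \<in> module_dual act. g \<circ> C \<in> conj_dual sharp act
            \<and> inv_into (conj_dual sharp act) (\<lambda>f. f \<circ> C) g = g \<circ> C)
       \<and> right_module_isomorphic (conj_dual sharp act) dual_scale dual_act
           (module_dual act) dual_scale dual_act
       \<and> (\<forall>f \<in> conj_dual sharp act. onorm (f \<circ> C) = onorm f)"
proof -
  interpret hilbert_module act ip by fact
  interpret star_conj_automorphism sharp by fact
  interpret sharp_hilbert_module act ip sharp C by unfold_locales fact
  have "inv_into (conj_dual sharp act) (\<lambda>f. f \<circ> C) g = g \<circ> C" if "g \<in> module_dual act" for g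
    using bij_betw_compose_conj module_dual_compose[OF that]
    by (intro inv_into_f_eq) (auto simp: bij_betw_def compose_conj_compose_conj)
  moreover have "onorm (f \<circ> C) = onorm f" if "f \<in> conj_dual sharp act" for f
    using that by (intro onorm_compose_conj) (simp add: conj_dual_eq_twisted twisted_dual_def)
  ultimately show ?thesis
    using right_module_hom_compose_conj bij_betw_compose_conj module_dual_compose
    unfolding right_module_isomorphic_def by blast
qed

end
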